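(* Let $\lambda$ be a nonzero real number and $x$ a real number. For any integers $n,k$ with $1\le k\le n$, we have $$T_{2,\lambda}(n+1,k\mid x)=\Big(x+\frac{k}{2}-n\lambda\Big)T_{2,\lambda}(n,k\mid x)+T_{2,\lambda}\Big(n,k-1\,\Big|\,x-\frac12\Big).$$
   Context: All generating functions are formal power series in $t$; for real $y$, $(1+\lambda t)^{y/\lambda}=\sum_{m\ge 0}(y)_{m,\lambda}\frac{t^m}{m!}$, where $(y)_{0,\lambda}=1$ and $(y)_{m,\lambda}=y(y-\lambda)\cdots(y-(m-1)\lambda)$ for $m\ge1$. For a nonnegative integer $k$, the degenerate central factorial polynomials of the second kind $T_{2,\lambda}(n,k\mid x)$ $(n\ge k)$ are defined by $$\frac{1}{k!}(1+\lambda t)^{\frac{x}{\lambda}}\Big((1+\lambda t)^{\frac{1}{2\lambda}}-(1+\lambda t)^{-\frac{1}{2\lambda}}\Big)^k=\sum_{n=k}^\infty T_{2,\lambda}(n,k\mid x)\frac{t^n}{n!}.$$ *)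

theory Defs
  imports Complex_Main "HOL-Computational_Algebra.Formal_Power_Series"
begin

definition degen_ffact :: "real \<Rightarrow> real \<Rightarrow> nat \<Rightarrow> real" where
  "degen_ffact lam y m = (\<Prod>i<m. y - real i * lam)"

text \<open>The formal power series \<open>(1 + lam t)\<close> raised to the power \<open>y / lam\<close>. The argument is
  \<open>y\<close>, not the exponent \<open>y / lam\<close>, so the exponent \<open>1 / (2 lam)\<close> corresponds to \<open>y = 1/2\<close>.\<close>

definition degen_exp :: "real \<Rightarrow> real \<Rightarrow> real fps" where
  "degen_exp lam y = Abs_fps (\<lambda>m. degen_ffact lam y m / fact m)"

definition T2_gf :: "real \<Rightarrow> nat \<Rightarrow> real \<Rightarrow> real fps" where
  "T2_gf lam k x =
     fps_const (1 / fact k) * degen_exp lam x * (degen_exp lam (1/2) - degen_exp lam (- (1/2))) ^ k"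

text \<open>The degenerate central factorial polynomials of the second kind. They are read off as
  coefficients for every \<open>n\<close>; for \<open>n < k\<close> the value is 0, so the generating function
  is a sum over \<open>n \<ge> k\<close> only.\<close>

definition T2 :: "real \<Rightarrow> nat \<Rightarrow> nat \<Rightarrow> real \<Rightarrow> real" where
  "T2 lam n k x = fact n * fps_nth (T2_gf lam k x) n"

lemma T2_eq_0:
  assumes "n < k"
  shows "T2 lam n k x = 0"
proof -
  define D where "D = degen_exp lam (1/2) - degen_exp lam (- (1/2))"
  have "fps_nth D 0 = 0"
    by (simp add: D_def degen_exp_def degen_ffact_def)
  then have "fps_nth (D ^ k) i = 0" if "i < k" for i
    using startsby_zero_power_prefix that by blast
  then have "fps_nth (fps_const (1 / fact k) * degen_exp lam x * D ^ k) n = 0"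
    using assms by (auto simp: fps_mult_nth intro!: sum.neutral)
  then show ?thesis
    by (simp add: T2_def T2_gf_def D_def)
qed

lemma T2_gf_eq: "T2_gf lam k x = Abs_fps (\<lambda>n. if n < k then 0 else T2 lam n k x / fact n)"
  using T2_eq_0[of _ k lam x] by (auto simp: fps_eq_iff T2_def)

end

theory Submission
  imports Defs
begin

text \<open>
  Write \<open>E\<^sub>y\<close> for the series \<open>(1 + lam t)\<close> to the power \<open>y / lam\<close>, and put
  \<open>D = E\<^bsub>1/2\<^esub> - E\<^bsub>-1/2\<^esub>\<close>. The derivation \<open>\<theta> = (1 + lam t) d/dt\<close> has \<open>E\<^sub>y\<close> as an
  eigenvector with eigenvalue \<open>y\<close>. Hence
  \<open>\<theta> D = (E\<^bsub>1/2\<^esub> + E\<^bsub>-1/2\<^esub>)/2 = D/2 + E\<^bsub>-1/2\<^esub>\<close>, and the Leibniz rule applied to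
  \<open>G\<^sub>k(x) = E\<^sub>x D\<^sup>k / k!\<close> gives
  \<open>\<theta> G\<^sub>k(x) = (x + k/2) G\<^sub>k(x) + E\<^sub>x E\<^bsub>-1/2\<^esub> D\<^bsup>k-1\<^esup> / (k-1)!\<close>.
  The last term is \<open>G\<^bsub>k-1\<^esub>(x - 1/2)\<close> because \<open>E\<^sub>a E\<^sub>b = E\<^bsub>a+b\<^esub>\<close>. On coefficients,
  \<open>\<theta>\<close> sends \<open>a\<^sub>n\<close> to \<open>(n+1) a\<^bsub>n+1\<^esub> + n lam a\<^sub>n\<close>; comparing coefficients of
  \<open>t\<^sup>n/n!\<close> therefore yields the recurrence, and the term \<open>n lam\<close> in it is exactly the
  contribution of the factor \<open>1 + lam t\<close> in \<open>\<theta>\<close>.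

  The product formula \<open>E\<^sub>a E\<^sub>b = E\<^bsub>a+b\<^esub>\<close> comes from the same derivation: the product is an
  eigenvector with eigenvalue \<open>a + b\<close>, and the coefficient formula for \<open>\<theta>\<close> shows that an
  eigenvector is determined by its eigenvalue and its constant term.
\<close>

unbundle fps_syntax

definition degen_deriv :: "real \<Rightarrow> real fps \<Rightarrow> real fps" where
  "degen_deriv lam F = (1 + fps_const lam * fps_X) * fps_deriv F"

lemma degen_deriv_nth:
  "degen_deriv lam F $ n = real (n + 1) * F $ (n + 1) + lam * real n * F $ n"
  by (cases n) (simp_all add: degen_deriv_def distrib_right mult.assoc)

lemma degen_deriv_diff: "degen_deriv lam (F - G) = degen_deriv lam F - degen_deriv lam G"
  by (simp add: degen_deriv_def algebra_simps)

lemma degen_deriv_mult: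
  "degen_deriv lam (F * G) = degen_deriv lam F * G + F * degen_deriv lam G"
  by (simp add: degen_deriv_def algebra_simps)

lemma degen_deriv_const_mult:
  "degen_deriv lam (fps_const c * F) = fps_const c * degen_deriv lam F"
  by (simp add: degen_deriv_def algebra_simps)

lemma degen_deriv_power_Suc:
  "degen_deriv lam (F ^ Suc m) = fps_const (real (Suc m)) * F ^ m * degen_deriv lam F"
  unfolding degen_deriv_def fps_deriv_power by (simp add: mult_ac)

lemma degen_exp_nth_0: "degen_exp lam y $ 0 = 1"
  by (simp add: degen_exp_def degen_ffact_def)

lemma degen_deriv_degen_exp:
  "degen_deriv lam (degen_exp lam y) = fps_const y * degen_exp lam y"
proof (rule fps_ext)
  fix n
  have "real (n + 1) * degen_exp lam y $ (n + 1) = (y - real n * lam) * degen_exp lam y $ n"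
    by (simp add: degen_exp_def degen_ffact_def divide_simps)
  then show "degen_deriv lam (degen_exp lam y) $ n = (fps_const y * degen_exp lam y) $ n"
    unfolding degen_deriv_nth by (simp add: left_diff_distrib)
qed

text \<open>The eigenvalue equation is a first-order recurrence for the coefficients in which the
  leading coefficient \<open>n + 1\<close> never vanishes, so each coefficient determines the next.\<close>

lemma degen_deriv_eigenvector_unique:
  assumes F: "degen_deriv lam F = fps_const c * F"
    and G: "degen_deriv lam G = fps_const c * G"
    and "F $ 0 = G $ 0"
  shows "F = G"
proof (rule fps_ext)
  fix n
  show "F $ n = G $ n"
  proof (induction n)
    case 0
    show ?case by fact
  next
    case (Suc n)
    have "real (n + 1) * H $ (n + 1) = (c - lam * real n) * H $ n"
      if "degen_deriv lam H = fps_const c * H" for H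
      using arg_cong[OF that, of "\<lambda>S. S $ n"] unfolding degen_deriv_nth
      by (simp add: algebra_simps)
    from this[OF F] this[OF G] Suc.IH
    have "real (n + 1) * F $ (n + 1) = real (n + 1) * G $ (n + 1)"
      by simp
    then show ?case by simp
  qed
qed

lemma degen_exp_add: "degen_exp lam (a + b) = degen_exp lam a * degen_exp lam b"
proof (rule degen_deriv_eigenvector_unique)
  show "degen_deriv lam (degen_exp lam (a + b)) = fps_const (a + b) * degen_exp lam (a + b)"
    by (rule degen_deriv_degen_exp)
  show "degen_deriv lam (degen_exp lam a * degen_exp lam b)
      = fps_const (a + b) * (degen_exp lam a * degen_exp lam b)"
    unfolding degen_deriv_mult degen_deriv_degen_exp fps_const_add[symmetric]
    by (simp add: algebra_simps del: fps_const_add)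
qed (simp add: degen_exp_nth_0)

text \<open>Rewriting \<open>(E\<^bsub>1/2\<^esub> + E\<^bsub>-1/2\<^esub>)/2\<close> through the difference \<open>D\<close> and \<open>E\<^bsub>-1/2\<^esub>\<close>, rather than
  through \<open>E\<^bsub>1/2\<^esub>\<close>, is what makes the shift in the recurrence go to \<open>x - 1/2\<close> and gives the
  sign of \<open>k/2\<close>.\<close>

lemma degen_deriv_central_difference:
  fixes lam :: real
  defines "D \<equiv> degen_exp lam (1/2) - degen_exp lam (- (1/2))"
  shows "degen_deriv lam D = fps_const (1/2) * D + degen_exp lam (- (1/2))"
proof -
  have half: "fps_const (- (1/2)) = fps_const (1/2) - (1 :: real fps)"
    by (simp add: fps_eq_iff)
  show ?thesis
    unfolding D_def degen_deriv_diff degen_deriv_degen_exp half by (simp add: algebra_simps)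
qed

lemma degen_deriv_T2_gf:
  "degen_deriv lam (T2_gf lam (Suc m) x)
    = fps_const (x + real (Suc m) / 2) * T2_gf lam (Suc m) x + T2_gf lam m (x - 1/2)"
proof -
  define D where "D = degen_exp lam (1/2) - degen_exp lam (- (1/2))"
  define E where "E = degen_exp lam x"
  define H where "H = degen_exp lam (- (1/2))"
  define c where "c = (1 / fact (Suc m) :: real)"
  define s where "s = real (Suc m)"
  have shift: "degen_exp lam (x - 1/2) = E * H"
    using degen_exp_add[of lam x "- (1/2)"] by (simp add: E_def H_def)
  have c: "fps_const (1 / fact m) = fps_const c * fps_const s"
    by (simp add: c_def s_def)
  have s: "fps_const (x + s / 2) = fps_const x + fps_const s * fps_const (1/2)"
    by simp
  have dD: "degen_deriv lam D = fps_const (1/2) * D + H"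
    unfolding D_def H_def by (rule degen_deriv_central_difference)
  have dE: "degen_deriv lam E = fps_const x * E"
    unfolding E_def by (rule degen_deriv_degen_exp)
  have "degen_deriv lam (fps_const c * (E * D ^ Suc m))
      = fps_const c * (fps_const x * E * D ^ Suc m
          + E * (fps_const s * D ^ m * (fps_const (1/2) * D + H)))"
    unfolding degen_deriv_const_mult
    unfolding degen_deriv_mult degen_deriv_power_Suc dD dE s_def ..
  also have "\<dots> = (fps_const x + fps_const s * fps_const (1/2)) * (fps_const c * (E * D ^ Suc m))
      + fps_const c * fps_const s * (E * H) * D ^ m"
    by (simp add: algebra_simps del: fps_const_mult fps_const_add)
  finally show ?thesis
    unfolding T2_gf_def shift c s D_def[symmetric] E_def[symmetric] c_def[symmetric]
      s_def[symmetric] mult.assoc .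
qed

theorem theorem0p4:
  fixes lam x :: real and n k :: nat
  assumes "lam \<noteq> 0" and "1 \<le> k" and "k \<le> n"
  shows "T2 lam (n + 1) k x =
    (x + real k / 2 - real n * lam) * T2 lam n k x + T2 lam n (k - 1) (x - 1/2)"
proof -
  define G where "G = T2_gf lam k x"
  obtain m where k: "k = Suc m"
    using \<open>1 \<le> k\<close> by (cases k) auto
  have "real (n + 1) * G $ (n + 1) + lam * real n * G $ n
      = (x + real k / 2) * G $ n + T2_gf lam m (x - 1/2) $ n"
    using arg_cong[OF degen_deriv_T2_gf[of lam m x], of "\<lambda>S. S $ n"]
    unfolding degen_deriv_nth G_def k by simp
  then have "real (n + 1) * G $ (n + 1)
      = (x + real k / 2 - real n * lam) * G $ n + T2_gf lam m (x - 1/2) $ n"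
    by (simp add: algebra_simps)
  then have "fact n * (real (n + 1) * G $ (n + 1))
      = fact n * ((x + real k / 2 - real n * lam) * G $ n + T2_gf lam m (x - 1/2) $ n)"
    by simp
  then show ?thesis
    unfolding T2_def G_def[symmetric] by (simp add: k algebra_simps)
qed

end
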